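(* Let $k \geq 2$ be an integer and let $X \subseteq S^{k-1}$. Then there exists $A \subseteq \mathbb{N}$ such that $X = D^{\underline{k}}(A)^\prime$ if and only if the following three conditions are satisfied: (i) $X$ is closed; (ii) $\boldsymbol{x} \in X$ implies $\pi(\boldsymbol{x}) \in X$, for every permutation $\pi$ of $\{1, \dots, k\}$; (iii) $\boldsymbol{x} \in X$ implies $\rho_I(\boldsymbol{x}) \in X$, for every $I \subseteq \{1, \dots, k\}$ that meets $\boldsymbol{x}$.
   Context: $\mathbb{N}$ denotes the set of positive integers and $\|\boldsymbol{x}\| := \sqrt{x_1^2 + \cdots + x_k^2}$ is the Euclidean norm on $\mathbb{R}^k$. Put $S^{k-1} := \{\boldsymbol{x} \in [0,1]^k : \|\boldsymbol{x}\| = 1\}$ (the part of the unit sphere with nonnegative coordinates), with the subspace topology from $\mathbb{R}^k$. For $\boldsymbol{a} \neq \boldsymbol{0}$ in $\mathbb{R}^k$, put $\rho(\boldsymbol{a}) := \boldsymbol{a}/\|\boldsymbol{a}\|$. For $A \subseteq \mathbb{N}$, let $A^{\underline{k}} := \{\boldsymbol{a} \in A^k : a_i \neq a_j \text{ for all } i \neq j\}$ and $D^{\underline{k}}(A) := \{\rho(\boldsymbol{a}) : \boldsymbol{a} \in A^{\underline{k}}\}$, regarded as a subset of the topological space $S^{k-1}$. For a subset $Y$ of a topological space, $Y^\prime$ denotes the set of accumulation points of $Y$. For a permutation $\pi$ of $\{1,\dots,k\}$ and $\boldsymbol{x} = (x_1,\dots,x_k) \in S^{k-1}$, put $\pi(\boldsymbol{x})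 := (x_{\pi(1)}, \dots, x_{\pi(k)})$. A set $I \subseteq \{1,\dots,k\}$ meets $\boldsymbol{x} \in S^{k-1}$ if there exists $j \in I$ such that $x_j \neq 0$; in that case $\rho_I(\boldsymbol{x}) := \rho(\boldsymbol{y})$, where $\boldsymbol{y} = (y_1,\dots,y_k)$ is defined by $y_i := x_i$ if $i \in I$ and $y_i := 0$ if $i \notin I$. *)

theory Defs
  imports "HOL-Analysis.Analysis"
begin

text \<open>The finite type \<open>'k\<close> plays the role of the coordinate index set \<open>{1, \<dots>, k}\<close>, with
  \<open>k = CARD('k)\<close>; \<open>norm\<close> on \<open>real ^ 'k\<close> is the Euclidean norm.\<close>

definition nonneg_sphere :: "(real ^ 'k) set" where
  "nonneg_sphere = {x. (\<forall>i. x $ i \<in> {0..1}) \<and> norm x = 1}"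

text \<open>Only meaningful for nonzero \<open>a\<close>; the value at \<open>0\<close> is \<open>0\<close>.\<close>

definition rho :: "real ^ 'k \<Rightarrow> real ^ 'k" where
  "rho a = a /\<^sub>R norm a"

definition distinct_tuples :: "nat set \<Rightarrow> (nat ^ 'k) set" where
  "distinct_tuples A = {a. (\<forall>i. a $ i \<in> A) \<and> (\<forall>i j. i \<noteq> j \<longrightarrow> a $ i \<noteq> a $ j)}"

definition direction_set :: "nat set \<Rightarrow> (real ^ 'k) set" where
  "direction_set A = {rho (\<chi> i. real (a $ i)) | a. a \<in> distinct_tuples A}"

definition permute_coords :: "('k \<Rightarrow> 'k) \<Rightarrow> real ^ 'k \<Rightarrow> real ^ 'k" where
  "permute_coords p x = (\<chi> i. x $ p i)"

definition meets :: "'k set \<Rightarrow> real ^ 'k \<Rightarrow> bool" where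
  "meets I x \<longleftrightarrow> (\<exists>j\<in>I. x $ j \<noteq> 0)"

definition rho_on :: "'k set \<Rightarrow> real ^ 'k \<Rightarrow> real ^ 'k" where
  "rho_on I x = rho (\<chi> i. if i \<in> I then x $ i else 0)"

end

theory Submission
  imports Defs
begin

text \<open>
  Necessity of (iii): if \<open>\<rho>(a)\<close> is close to \<open>x\<close> and \<open>a\<close> is large, overwriting the coordinates
  of \<open>a\<close> outside \<open>I\<close> by bounded elements of \<open>A\<close> gives a direction close to \<open>\<rho>\<^sub>I(x)\<close>. It differs
  from \<open>\<rho>\<^sub>I(x)\<close> because all its coordinates are positive.

  Sufficiency: let \<open>x\<^sub>0, x\<^sub>1, \<dots>\<close> be dense in \<open>X\<close>, each value recurring infinitely often. \<open>A\<close> is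
  a union of blocks, the \<open>n\<close>-th one being a good integer approximation of a large multiple of the
  nonzero coordinates of \<open>x\<^sub>n\<close>, so large that all earlier blocks are negligible against it.
  The direction of a tuple is then governed by the latest block it uses, hence close to a point
  \<open>\<rho>\<^sub>I(\<pi>(x\<^sub>n))\<close> of \<open>X\<close>; conversely a block completed by earlier elements gives directions close
  to \<open>x\<^sub>n\<close>. Keeping the direction of a block different from \<open>x\<^sub>n\<close> makes isolated points of \<open>X\<close>
  accumulation points.
\<close>

section \<open>Directions, coordinate permutations and limit points of direction sets\<close>

lemma norm_scaleR_rho: "norm x *\<^sub>R rho x = x"
  by (cases "x = 0") (simp_all add: rho_def)

text \<open>Scaling \<open>u\<close> by \<open>1 / M\<close> keeps its direction and brings it close
  to \<open>w\<close>, coordinatewise and hence in norm. Normalising two vectors then magnifies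
  their distance by a factor of at most \<open>2 / norm w\<close>.\<close>

lemma dist_rho_le:
  fixes u w :: "real ^ 'k"
  assumes "M > 0" "w \<noteq> 0" and close: "\<And>i. \<bar>u $ i - M * w $ i\<bar> \<le> \<epsilon> * M"
  shows "dist (rho u) (rho w) \<le> 2 * real CARD('k) * \<epsilon> / norm w"
proof -
  define v where "v = u /\<^sub>R M"
  have rv: "rho v = rho u"
    using \<open>M > 0\<close> by (simp add: rho_def v_def)
  have "\<bar>(v - w) $ i\<bar> \<le> \<epsilon>" for i
    using close[of i] \<open>M > 0\<close> by (simp add: v_def field_simps abs_le_iff)
  then have "(\<Sum>i\<in>UNIV. \<bar>(v - w) $ i\<bar>) \<le> real CARD('k) * \<epsilon>"
    using sum_bounded_above[of UNIV "\<lambda>i. \<bar>(v - w) $ i\<bar>" \<epsilon>] by simp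
  then have vw: "norm (v - w) \<le> real CARD('k) * \<epsilon>"
    using norm_le_l1_cart[of "v - w"] by linarith
  have "norm (rho v - rho w) * norm w \<le> 2 * norm (v - w)"
  proof -
    \<comment> \<open>Both vectors are split into norm times direction. The last term is then
      controlled by the difference of the norms, since \<open>norm (rho v)\<close> is at most 1,
      also for \<open>v = 0\<close>.\<close>
    have "norm w *\<^sub>R (rho v - rho w) = (v - w) + (norm w - norm v) *\<^sub>R rho v"
      by (simp add: algebra_simps norm_scaleR_rho)
    then have "norm w * norm (rho v - rho w) \<le> norm (v - w) + \<bar>norm w - norm v\<bar> * norm (rho v)"
      by (metis abs_norm_cancel norm_scaleR norm_triangle_ineq)
    moreover have "norm (rho v) \<le> 1"
      by (cases "v = 0") (simp_all add: rho_def)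
    ultimately have "norm w * norm (rho v - rho w) \<le> norm (v - w) + \<bar>norm w - norm v\<bar>"
      by (smt (verit) mult_left_le abs_ge_zero)
    then show ?thesis
      using norm_triangle_ineq3[of w v] by (simp add: norm_minus_commute mult.commute)
  qed
  then show ?thesis
    using vw \<open>w \<noteq> 0\<close> by (simp add: dist_norm rv field_simps)
qed

lemma permute_coords_diff: "permute_coords p x - permute_coords p y = permute_coords p (x - y)"
  by (simp add: permute_coords_def vec_eq_iff)

lemma norm_permute_coords:
  fixes x :: "real ^ 'k"
  assumes "p permutes UNIV"
  shows "norm (permute_coords p x) = norm x"
proof -
  have "(\<Sum>i\<in>UNIV. (norm (x $ p i))\<^sup>2) = (\<Sum>i\<in>UNIV. (norm (x $ i))\<^sup>2)"
    using sum.permute[OF assms, of "\<lambda>i. (norm (x $ i))\<^sup>2"] by (simp add: o_def)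
  then show ?thesis
    by (simp add: norm_vec_def L2_set_def permute_coords_def)
qed

lemma dist_permute_coords:
  fixes x y :: "real ^ 'k"
  assumes "p permutes UNIV"
  shows "dist (permute_coords p x) (permute_coords p y) = dist x y"
  by (simp add: dist_norm permute_coords_diff norm_permute_coords[OF assms])

lemma rho_permute_coords:
  fixes x :: "real ^ 'k"
  assumes "p permutes UNIV"
  shows "rho (permute_coords p x) = permute_coords p (rho x)"
  by (simp add: rho_def norm_permute_coords[OF assms]) (simp add: permute_coords_def vec_eq_iff)

lemma finite_vecs_in:
  fixes F :: "'a set"
  assumes "finite F"
  shows "finite {b :: 'a ^ 'k. \<forall>i. b $ i \<in> F}"
proof -
  have "{b :: 'a ^ 'k. \<forall>i. b $ i \<in> F} \<subseteq> vec_lambda ` (UNIV \<rightarrow>\<^sub>E F)"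
  proof
    fix b :: "'a ^ 'k" assume "b \<in> {b. \<forall>i. b $ i \<in> F}"
    then have "vec_nth b \<in> UNIV \<rightarrow>\<^sub>E F" by auto
    then show "b \<in> vec_lambda ` (UNIV \<rightarrow>\<^sub>E F)"
      by (metis image_eqI vec_nth_inverse)
  qed
  then show ?thesis
    by (rule finite_subset) (simp add: finite_PiE assms)
qed

lemma norm_tuple_pos:
  assumes "(b :: nat ^ 'k) \<in> distinct_tuples A" "A \<subseteq> {n. n > 0}"
  shows "norm (\<chi> i. real (b $ i)) > 0"
proof -
  have "b $ i > 0" for i
    using assms unfolding distinct_tuples_def by blast
  then show ?thesis
    by (auto simp: vec_eq_iff)
qed

text \<open>Serves to tell directions of tuples apart from points with a vanishing
  coordinate.\<close>

lemma rho_tuple_pos: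
  assumes "(b :: nat ^ 'k) \<in> distinct_tuples A" "A \<subseteq> {n. n > 0}"
  shows "rho (\<chi> i. real (b $ i)) $ j > 0"
proof -
  have "b $ j > 0"
    using assms unfolding distinct_tuples_def by blast
  then show ?thesis
    using norm_tuple_pos[OF assms] by (simp add: rho_def)
qed

lemma direction_set_subset:
  assumes "A \<subseteq> {n. n > 0}"
  shows "(direction_set A :: (real ^ 'k) set) \<subseteq> nonneg_sphere"
proof
  fix d :: "real ^ 'k" assume "d \<in> direction_set A"
  then obtain b where b: "b \<in> distinct_tuples A" and d: "d = rho (\<chi> i. real (b $ i))"
    unfolding direction_set_def by blast
  have n: "norm d = 1"
    using norm_tuple_pos[OF b assms] by (simp add: d rho_def)
  moreover have "d $ i \<in> {0..1}" for i
    using rho_tuple_pos[OF b assms, of i] component_le_norm_cart[of d i] n d by auto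
  ultimately show "d \<in> nonneg_sphere"
    by (simp add: nonneg_sphere_def)
qed

lemma closed_nonneg_sphere: "closed (nonneg_sphere :: (real ^ 'k) set)"
proof -
  have eq: "nonneg_sphere = {x :: real ^ 'k. (\<forall>i. 0 \<le> x $ i \<and> x $ i \<le> 1) \<and> norm x = 1}"
    by (simp add: nonneg_sphere_def)
  show ?thesis
    unfolding eq
    by (intro closed_Collect_conj closed_Collect_all closed_Collect_le closed_Collect_eq continuous_intros)
qed

lemma islimpt_direction_set_in_sphere:
  assumes "A \<subseteq> {n. n > 0}" "y islimpt direction_set A"
  shows "(y :: real ^ 'k) \<in> nonneg_sphere"
  using closed_nonneg_sphere[where 'k = 'k] islimpt_subset[OF assms(2) direction_set_subset[OF assms(1)]]
  by (simp add: closed_limpt)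

text \<open>The sphere part is closed and contains all directions, so accumulation in the subspace
  and in the ambient space agree.\<close>

lemma derived_set_direction_set:
  assumes "A \<subseteq> {n. n > 0}"
  shows "top_of_set nonneg_sphere derived_set_of direction_set A =
    {x :: real ^ 'k. x islimpt direction_set A}"
proof -
  have "nonneg_sphere \<inter> direction_set A = (direction_set A :: (real ^ 'k) set)"
    using direction_set_subset[OF assms] by blast
  then show ?thesis
    using islimpt_direction_set_in_sphere[OF assms]
    unfolding derived_set_of_subtopology by (auto simp: derived_set_of_def islimpt_def)
qed

text \<open>Only finitely many tuples have all entries in \<open>F\<close>, and removing finitely
  many directions preserves limit points.\<close>

lemma islimpt_direction_set_large:
  fixes y :: "real ^ 'k"
  assumes "y islimpt direction_set A" "finite F" "e > 0"
  obtains b where "b \<in> distinct_tuples A" "\<exists>i. b $ i \<notin> F"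
    "dist (rho (\<chi> i. real (b $ i))) y < e"
proof -
  let ?r = "\<lambda>b :: nat ^ 'k. rho (\<chi> i. real (b $ i))"
  let ?D = "?r ` {b \<in> distinct_tuples A. \<exists>i. b $ i \<notin> F}"
  have "direction_set A \<subseteq> ?r ` {b. \<forall>i. b $ i \<in> F} \<union> ?D"
    unfolding direction_set_def by blast
  then have "y islimpt ?r ` {b. \<forall>i. b $ i \<in> F} \<union> ?D"
    using assms(1) islimpt_subset by blast
  then have "y islimpt ?D"
    using finite_vecs_in[OF assms(2), where 'k = 'k] by (simp add: islimpt_Un_finite)
  then show ?thesis
    using assms(3) that unfolding islimpt_approachable by blast
qed

subsection \<open>Closure properties of the derived set\<close>

text \<open>Permuting coordinates is an isometry that commutes with \<open>rho\<close> and preserves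
  tuples of distinct elements.\<close>

lemma derived_direction_set_permute:
  fixes y :: "real ^ 'k"
  assumes y: "y islimpt direction_set A" and p: "p permutes UNIV"
  shows "permute_coords p y islimpt direction_set A"
  unfolding islimpt_approachable
proof (intro allI impI)
  fix e :: real assume "e > 0"
  then obtain z where z: "z \<in> direction_set A" "z \<noteq> y" "dist z y < e"
    using y unfolding islimpt_approachable by blast
  obtain b where b: "b \<in> distinct_tuples A" and zb: "z = rho (\<chi> i. real (b $ i))"
    using z(1) unfolding direction_set_def by blast
  have "(\<chi> i. b $ p i) \<in> distinct_tuples A"
    using b permutes_inj[OF p] by (auto simp: distinct_tuples_def inj_eq)
  moreover have "permute_coords p z = rho (\<chi> i. real ((\<chi> i. b $ p i) $ i))"
    using rho_permute_coords[OF p, of "\<chi> i. real (b $ i)"] by (simp add: zb permute_coords_def)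
  ultimately have "permute_coords p z \<in> direction_set A"
    unfolding direction_set_def by blast
  moreover have "permute_coords p z \<noteq> permute_coords p y"
    using z(2) dist_permute_coords[OF p, of z y] by auto
  moreover have "dist (permute_coords p z) (permute_coords p y) < e"
    using z(3) by (simp add: dist_permute_coords[OF p])
  ultimately show "\<exists>x'\<in>direction_set A. x' \<noteq> permute_coords p y \<and> dist x' (permute_coords p y) < e"
    by blast
qed

lemma islimpt_direction_set_infinite:
  fixes y :: "real ^ 'k"
  assumes "y islimpt direction_set A"
  shows "infinite A"
proof
  assume "finite A"
  obtain b :: "nat ^ 'k" where "b \<in> distinct_tuples A" "\<exists>i. b $ i \<notin> A"
    by (rule islimpt_direction_set_large[OF assms \<open>finite A\<close> zero_less_one])
  then show False
    by (simp add: distinct_tuples_def)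
qed

lemma derived_direction_set_rho_on:
  fixes y :: "real ^ 'k"
  assumes y: "y islimpt direction_set A" and A: "A \<subseteq> {n. n > 0}" and I: "meets I y"
  shows "rho_on I y islimpt direction_set A"
proof (cases "I = UNIV")
  case True
  have "norm y = 1"
    using islimpt_direction_set_in_sphere[OF A y] by (simp add: nonneg_sphere_def)
  then have "rho_on I y = y"
    using True by (simp add: rho_on_def rho_def)
  then show ?thesis
    using y by simp
next
  case False
  \<comment> \<open>At \<open>j\<close> the point \<open>rho_on I y\<close> vanishes, which
    separates it from every direction of a tuple; this is why \<open>I = UNIV\<close> is treated on
    its own.\<close>
  then obtain j where j: "j \<notin> I"
    by blast
  define w where "w = (\<chi> i. if i \<in> I then y $ i else 0)"
  have "w \<noteq> 0"
    using I by (auto simp: meets_def w_def vec_eq_iff)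
  \<comment> \<open>A fixed supply of fillers: a tuple uses at most CARD('k) of these elements, so
    enough remain for all coordinates outside \<open>I\<close>.\<close>
  obtain F where F: "F \<subseteq> A" "finite F" "card F = 2 * CARD('k)"
    using islimpt_direction_set_infinite[OF y] by (meson infinite_arbitrarily_large)
  show ?thesis
    unfolding islimpt_approachable
  proof (intro allI impI)
    fix e :: real assume "e > 0"
    have w_eq: "rho_on I y = rho w"
      by (simp add: rho_on_def w_def)
    \<comment> \<open>With this value \<open>dist_rho_le\<close> yields the bound
      \<open>e / 2\<close>.\<close>
    define \<epsilon> where "\<epsilon> = e * norm w / (4 * real CARD('k))"
    have "\<epsilon> > 0"
      using \<open>e > 0\<close> \<open>w \<noteq> 0\<close> by (simp add: \<epsilon>_def)
    \<comment> \<open>An entry beyond \<open>R\<close> makes the norm \<open>M\<close> of the tuple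
      so large that every filler is at most \<open>\<epsilon> * M\<close>.\<close>
    define R where "R = nat \<lceil>real (Max F) / \<epsilon>\<rceil>"
    obtain b i0 where b: "b \<in> distinct_tuples A" and i0: "b $ i0 \<notin> {..R}"
      and bdist: "dist (rho (\<chi> i. real (b $ i))) y < \<epsilon>"
      using islimpt_direction_set_large[OF y, of "{..R}" \<epsilon>] \<open>\<epsilon> > 0\<close> by blast
    define M where "M = norm (\<chi> i. real (b $ i))"
    have "M > 0"
      unfolding M_def by (rule norm_tuple_pos[OF b A])
    have "real R \<le> M"
      using component_le_norm_cart[of "\<chi> i. real (b $ i)" i0] i0 by (simp add: M_def)
    then have "real (Max F) / \<epsilon> \<le> M"
      unfolding R_def by linarith
    then have FM: "real f \<le> \<epsilon> * M" if "f \<in> F" for f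
    proof -
      have "real f \<le> real (Max F)"
        using Max_ge[OF F(2) that] by simp
      also have "\<dots> \<le> \<epsilon> * M"
        using \<open>real (Max F) / \<epsilon> \<le> M\<close> \<open>\<epsilon> > 0\<close> by (simp add: field_simps)
      finally show ?thesis .
    qed
    have "card (F - range (($) b)) \<ge> CARD('k)"
      using diff_card_le_card_Diff[of "range (($) b)" F] card_image_le[of UNIV "($) b"] F(3) by simp
    then obtain g :: "'k \<Rightarrow> nat" where g: "range g \<subseteq> F - range (($) b)" "inj g"
      using card_le_inj[of "UNIV :: 'k set" "F - range (($) b)"] F(2) by auto
    define c :: "nat ^ 'k" where "c = (\<chi> i. if i \<in> I then b $ i else g i)"
    have gb: "g l \<noteq> b $ i" "b $ i \<noteq> g l" "g l \<in> A" for i l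
      using g(1) F(1) by auto
    have c: "c \<in> distinct_tuples A"
      using b gb g(2) by (simp add: distinct_tuples_def c_def inj_eq)
    have "\<bar>(\<chi> i. real (c $ i)) $ i - M * w $ i\<bar> \<le> \<epsilon> * M" for i
    proof (cases "i \<in> I")
      case True
      have "rho (\<chi> i. real (b $ i)) $ i = real (b $ i) / M"
        by (simp add: rho_def M_def field_simps)
      then have "\<bar>real (b $ i) / M - y $ i\<bar> \<le> \<epsilon>"
        using bdist component_le_norm_cart[of "rho (\<chi> i. real (b $ i)) - y" i] by (simp add: dist_norm)
      then have "\<bar>real (b $ i) - M * y $ i\<bar> \<le> \<epsilon> * M"
        using \<open>M > 0\<close> by (simp add: abs_le_iff field_simps)
      then show ?thesis
        using True by (simp add: c_def w_def)
    next
      case False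
      then show ?thesis
        using FM[of "g i"] g(1) by (auto simp: c_def w_def)
    qed
    from dist_rho_le[OF \<open>M > 0\<close> \<open>w \<noteq> 0\<close> this]
    have "dist (rho (\<chi> i. real (c $ i))) (rho w) < e"
      using \<open>e > 0\<close> \<open>w \<noteq> 0\<close> by (simp add: \<epsilon>_def field_simps)
    moreover have "rho w $ j = 0"
      using j by (simp add: rho_def w_def)
    then have "rho (\<chi> i. real (c $ i)) \<noteq> rho w"
      using rho_tuple_pos[OF c A, of j] by auto
    moreover have "rho (\<chi> i. real (c $ i)) \<in> direction_set A"
      using c unfolding direction_set_def by blast
    ultimately show "\<exists>x'\<in>direction_set A. x' \<noteq> rho_on I y \<and> dist x' (rho_on I y) < e"
      unfolding w_eq by blast
  qed
qed

subsection \<open>Integer approximations of directions\<close>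

text \<open>Both vectors are multiples of \<open>x\<close> by their norms, and a common nonzero
  coordinate forces the two factors to agree.\<close>

lemma rho_eq_imp_eq_on_others:
  fixes u v x :: "real ^ 'k"
  assumes "rho u = x" "rho v = x" "u $ j = v $ j" "u $ j \<noteq> 0"
  shows "u = v"
proof -
  have u: "u = norm u *\<^sub>R x" and v: "v = norm v *\<^sub>R x"
    using norm_scaleR_rho[of u] norm_scaleR_rho[of v] assms(1,2) by simp_all
  then have "norm u * x $ j = norm v * x $ j" "norm u * x $ j \<noteq> 0"
    using assms(3,4) by (metis vector_scaleR_component real_scaleR_def)+
  then have "norm u = norm v"
    by simp
  then show ?thesis
    using u v by metis
qed

text \<open>The residues modulo \<open>K\<close> keep the entries distinct. Two rounding patterns that differ in
  exactly one coordinate are never proportional, so one of them avoids the direction \<open>x\<close>.\<close>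

lemma approximating_tuple:
  fixes x :: "real ^ 'k" and B :: nat
  assumes card: "CARD('k) \<ge> 2" and x: "\<And>i. x $ i \<ge> 0" and "\<epsilon> > 0"
  obtains a :: "nat ^ 'k" and M :: real where
    "M > 0" "inj (($) a)" "\<And>i. \<bar>real (a $ i) - M * x $ i\<bar> \<le> \<epsilon> * M" "real B \<le> \<epsilon> * M"
    "\<And>i. x $ i \<noteq> 0 \<Longrightarrow> a $ i > B" "rho (\<chi> i. real (a $ i)) \<noteq> x"
proof -
  define C where "C = CARD('k)"
  \<comment> \<open>Offsets up to \<open>2 * C\<close> stay below this modulus.\<close>
  define K where "K = 2 * C + 1"
  have "\<exists>h :: 'k \<Rightarrow> nat. range h \<subseteq> {1..C} \<and> inj h"
    by (rule card_le_inj) (auto simp: C_def)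
  then obtain h :: "'k \<Rightarrow> nat" where h: "range h \<subseteq> {1..C}" "inj h"
    by blast
  have h1: "1 \<le> h i" "h i \<le> C" for i
    using h(1) by (auto simp: image_subset_iff)
  have "\<not> CARD('k) \<le> Suc 0"
    using card by simp
  then obtain i0 j0 :: 'k where ij: "i0 \<noteq> j0"
    by (auto simp: card_le_Suc0_iff_eq)
  \<comment> \<open>Raising one value by \<open>C\<close> lifts it above all values of
    \<open>h\<close>, so injectivity survives while only coordinate \<open>i0\<close>
    changes.\<close>
  define h' where "h' = h(i0 := h i0 + C)"
  have h': "inj h'" "\<And>i. 1 \<le> h' i" "\<And>i. h' i \<le> 2 * C"
  proof -
    show "inj h'"
    proof (rule injI)
      fix i j assume "h' i = h' j"
      then show "i = j"
        using h1[of i] h1[of j] h1[of i0] inj_eq[OF h(2), of i j]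
        by (simp add: h'_def split: if_splits)
    qed
    show "1 \<le> h' i" "h' i \<le> 2 * C" for i
      using h1[of i] by (auto simp: h'_def)
  qed
  \<comment> \<open>The terms serve in turn: positivity of \<open>M\<close>; absorbing an error of
    \<open>2 * K\<close> from rounding and offset; making \<open>B\<close> negligible; pushing
    entries at nonzero coordinates above \<open>B\<close>. For \<open>x $ i = 0\<close> the last
    quotient is 0 by convention and harmless.\<close>
  define T where "T = Max ({1, 2 / \<epsilon>, real B / \<epsilon>} \<union> range (\<lambda>i. (real B + 1) / x $ i))"
  have T: "1 \<le> T" "2 / \<epsilon> \<le> T" "real B / \<epsilon> \<le> T" "(real B + 1) / x $ i \<le> T" for i
    unfolding T_def by (intro Max_ge; simp)+
  define M where "M = real K * T"
  have K: "K \<ge> 1"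
    by (simp add: K_def)
  define t :: "('k \<Rightarrow> nat) \<Rightarrow> nat ^ 'k" where
    "t f = (\<chi> i. K * nat \<lfloor>T * x $ i\<rfloor> + f i)" for f
  have M0: "M > 0"
    using T(1) K by (simp add: M_def)
  have inj: "inj (($) (t f))" if "inj f" "\<And>i. f i \<le> 2 * C" for f
  proof (rule injI)
    fix i j assume "t f $ i = t f $ j"
    then have "t f $ i mod K = t f $ j mod K"
      by simp
    moreover have "t f $ l mod K = f l" for l
    proof -
      have "f l < K"
        using that(2)[of l] by (simp add: K_def)
      then show ?thesis
        by (simp add: t_def)
    qed
    ultimately show "i = j"
      using \<open>inj f\<close> by (simp add: inj_eq)
  qed
  have close: "\<bar>real (t f $ i) - M * x $ i\<bar> \<le> \<epsilon> * M" if "f i \<le> 2 * C" for f i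
  proof -
    have fl: "real (nat \<lfloor>T * x $ i\<rfloor>) = of_int \<lfloor>T * x $ i\<rfloor>"
      using x[of i] T(1) by simp
    have d: "real (t f $ i) - M * x $ i = real K * (of_int \<lfloor>T * x $ i\<rfloor> - T * x $ i) + real (f i)"
      by (simp add: t_def M_def fl algebra_simps)
    have "\<bar>of_int \<lfloor>T * x $ i\<rfloor> - T * x $ i\<bar> \<le> 1"
      by linarith
    then have "\<bar>real K * (of_int \<lfloor>T * x $ i\<rfloor> - T * x $ i)\<bar> \<le> real K * 1"
      unfolding abs_mult by (intro mult_mono) auto
    moreover have "real (f i) \<le> real K"
      using that by (simp add: K_def)
    ultimately have "\<bar>real (t f $ i) - M * x $ i\<bar> \<le> real K * 2"
      unfolding d by linarith
    also have "\<dots> \<le> real K * (\<epsilon> * T)"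
      using T(2) \<open>\<epsilon> > 0\<close> by (intro mult_left_mono) (auto simp: field_simps)
    finally show ?thesis
      by (simp add: M_def algebra_simps)
  qed
  have "real B \<le> \<epsilon> * T"
    using T(3) \<open>\<epsilon> > 0\<close> by (simp add: field_simps)
  also have "\<dots> \<le> \<epsilon> * M"
    using \<open>\<epsilon> > 0\<close> T(1) K by (simp add: M_def mult_le_cancel_right1)
  finally have BM: "real B \<le> \<epsilon> * M" .
  have big: "t f $ i > B" if "x $ i \<noteq> 0" for f i
  proof -
    have "x $ i > 0"
      using that x[of i] by simp
    then have "real B + 1 \<le> T * x $ i"
      using T(4)[of i] by (simp add: field_simps)
    then have "B < nat \<lfloor>T * x $ i\<rfloor>"
      by linarith
    also have "\<dots> \<le> t f $ i"
      using K by (simp add: t_def trans_le_add1)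
    finally show ?thesis .
  qed
  have "rho (\<chi> i. real (t h $ i)) \<noteq> x \<or> rho (\<chi> i. real (t h' $ i)) \<noteq> x"
  proof (rule ccontr)
    assume "\<not> ?thesis"
    then have "rho (\<chi> i. real (t h $ i)) = x" "rho (\<chi> i. real (t h' $ i)) = x"
      by blast+
    \<comment> \<open>The patterns agree at \<open>j0\<close>, where the offset is at least 1, so
      equal directions would make them equal at \<open>i0\<close> as well.\<close>
    moreover have "t h $ j0 = t h' $ j0" "t h $ j0 \<noteq> 0"
      using ij h1(1)[of j0] by (simp_all add: t_def h'_def)
    then have "(\<chi> i. real (t h $ i)) $ j0 = (\<chi> i. real (t h' $ i)) $ j0"
      "(\<chi> i. real (t h $ i)) $ j0 \<noteq> 0"
      by simp_all
    ultimately have "(\<chi> i. real (t h $ i)) = (\<chi> i. real (t h' $ i))"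
      by (rule rho_eq_imp_eq_on_others)
    then have "t h $ i0 = t h' $ i0"
      by (simp add: vec_eq_iff)
    then show False
      using h1[of i0] by (simp add: t_def h'_def)
  qed
  then obtain f where f: "inj f" "\<And>i. f i \<le> 2 * C" "rho (\<chi> i. real (t f $ i)) \<noteq> x"
  proof
    have "h i \<le> 2 * C" for i
      using h1(2)[of i] by linarith
    moreover assume "rho (\<chi> i. real (t h $ i)) \<noteq> x"
    ultimately show ?thesis
      using h(2) by (rule_tac that)
  next
    assume "rho (\<chi> i. real (t h' $ i)) \<noteq> x"
    with h'(1,3) show ?thesis
      by (rule that)
  qed
  show ?thesis
    by (rule that[OF M0 inj[OF f(1,2)] close[OF f(2)] BM big f(3)])
qed

text \<open>Dependent choice on triples: besides the tuple and its scale, the state carries a bound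
  \<open>B\<close> on all entries so far. The relation \<open>Q\<close> links only consecutive
  states; monotonicity of \<open>B\<close> extends the comparison to all
  \<open>m < n\<close>.\<close>

lemma ex_growing_blocks:
  fixes x :: "nat \<Rightarrow> real ^ 'k" and \<epsilon> :: "nat \<Rightarrow> real"
  assumes card: "CARD('k) \<ge> 2" and x: "\<And>n i. x n $ i \<ge> 0" and eps: "\<And>n. \<epsilon> n > 0"
  obtains a :: "nat \<Rightarrow> nat ^ 'k" and M :: "nat \<Rightarrow> real" where
    "\<And>n. M n > 0" "\<And>n. inj (($) (a n))"
    "\<And>n i. \<bar>real (a n $ i) - M n * x n $ i\<bar> \<le> \<epsilon> n * M n"
    "\<And>n. rho (\<chi> i. real (a n $ i)) \<noteq> x n"
    "\<And>n i. x n $ i \<noteq> 0 \<Longrightarrow> a n $ i > 0"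
    "\<And>m n i. m < n \<Longrightarrow> real (a m $ i) \<le> \<epsilon> n * M n"
    "\<And>m n i j. m < n \<Longrightarrow> x n $ j \<noteq> 0 \<Longrightarrow> a m $ i < a n $ j"
proof -
  define P where "P = (\<lambda>n (a :: nat ^ 'k, M :: real, B :: nat).
    M > 0 \<and> inj (($) a) \<and> (\<forall>i. \<bar>real (a $ i) - M * x n $ i\<bar> \<le> \<epsilon> n * M) \<and>
    rho (\<chi> i. real (a $ i)) \<noteq> x n \<and> (\<forall>i. x n $ i \<noteq> 0 \<longrightarrow> a $ i > 0) \<and> (\<forall>i. a $ i \<le> B))"
  define Q where "Q = (\<lambda>n (a :: nat ^ 'k, M :: real, B :: nat)
      (a' :: nat ^ 'k, M' :: real, B' :: nat).
    B \<le> B' \<and> real B \<le> \<epsilon> (Suc n) * M' \<and> (\<forall>i. x (Suc n) $ i \<noteq> 0 \<longrightarrow> a' $ i > B))"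
  have step: "\<exists>a M B'. P n (a, M, B') \<and> B \<le> B' \<and> real B \<le> \<epsilon> n * M \<and>
    (\<forall>i. x n $ i \<noteq> 0 \<longrightarrow> a $ i > B)" for n B
  proof -
    obtain a :: "nat ^ 'k" and M where a: "M > 0" "inj (($) a)"
      "\<And>i. \<bar>real (a $ i) - M * x n $ i\<bar> \<le> \<epsilon> n * M" "real B \<le> \<epsilon> n * M"
      "\<And>i. x n $ i \<noteq> 0 \<Longrightarrow> a $ i > B" "rho (\<chi> i. real (a $ i)) \<noteq> x n"
      using approximating_tuple[OF card x eps, of n n B] by metis
    \<comment> \<open>The new bound dominates both the old one and every entry of the new
      tuple.\<close>
    have "a $ i \<le> B + sum (($) a) UNIV" for i
      using member_le_sum[of i UNIV "($) a"] by simp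
    then have "P n (a, M, B + sum (($) a) UNIV)"
      using a le_less_trans[OF zero_le a(5)] by (simp add: P_def)
    then show ?thesis
      using a by (intro exI[of _ a] exI[of _ M] exI[of _ "B + sum (($) a) UNIV"]) auto
  qed
  have "\<exists>s. P 0 s"
    using step[of 0 0] by blast
  moreover have "\<exists>s'. P (Suc n) s' \<and> Q n s s'" if "P n s" for n s
  proof -
    obtain a M B where s: "s = (a, M, B)"
      by (cases s) auto
    obtain a' M' B' where "P (Suc n) (a', M', B')" "B \<le> B'" "real B \<le> \<epsilon> (Suc n) * M'"
        "\<forall>i. x (Suc n) $ i \<noteq> 0 \<longrightarrow> a' $ i > B"
      using step[of "Suc n" B] by blast
    then show ?thesis
      by (intro exI[of _ "(a', M', B')"]) (simp add: Q_def s)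
  qed
  ultimately obtain f where f: "\<And>n. P n (f n)" "\<And>n. Q n (f n) (f (Suc n))"
    using dependent_nat_choice[of P Q] by blast
  define a where "a n = fst (f n)" for n
  define M where "M n = fst (snd (f n))" for n
  define B where "B n = snd (snd (f n))" for n
  have fn: "f n = (a n, M n, B n)" for n
    by (simp add: a_def M_def B_def)
  have P: "P n (a n, M n, B n)" for n
    using f(1)[of n] by (simp add: fn)
  have Q: "Q n (a n, M n, B n) (a (Suc n), M (Suc n), B (Suc n))" for n
    using f(2)[of n] by (simp add: fn)
  have mono: "B m \<le> B n" if "m \<le> n" for m n
    using that by (rule lift_Suc_mono_le[of B, rotated]) (use Q in \<open>simp add: Q_def\<close>)
  have le_B: "a m $ i \<le> B n" if "m \<le> n" for m n i
    using P[of m] mono[OF that] by (auto simp: P_def intro: order_trans)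
  have small: "real (a m $ i) \<le> \<epsilon> n * M n" if "m < n" for m n i
  proof -
    obtain l where l: "n = Suc l" "m \<le> l"
      using \<open>m < n\<close> by (cases n) auto
    have "real (a m $ i) \<le> real (B l)"
      using le_B[OF l(2)] by simp
    also have "\<dots> \<le> \<epsilon> n * M n"
      using Q[of l] by (simp add: Q_def l(1))
    finally show ?thesis .
  qed
  have less: "a m $ i < a n $ j" if "m < n" "x n $ j \<noteq> 0" for m n i j
  proof -
    obtain l where l: "n = Suc l" "m \<le> l"
      using \<open>m < n\<close> by (cases n) auto
    have "a m $ i \<le> B l"
      by (rule le_B[OF l(2)])
    also have "\<dots> < a n $ j"
      using Q[of l] that(2) by (simp add: Q_def l(1))
    finally show ?thesis .
  qed
  show ?thesis
    by (rule that[of M a]) (use P small less in \<open>simp_all add: P_def\<close>)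
qed

text \<open>The complements of \<open>I\<close> and of its image have equal size, so any bijection
  between them completes \<open>f\<close>.\<close>

lemma inj_on_extends_permutation:
  fixes f :: "'a::finite \<Rightarrow> 'a"
  assumes "inj_on f I"
  obtains p where "p permutes UNIV" "\<And>i. i \<in> I \<Longrightarrow> p i = f i"
proof -
  have "card (- I) = card (- f ` I)"
    using card_image[OF assms] by (simp add: Compl_eq_Diff_UNIV card_Diff_subset)
  then obtain g where g: "bij_betw g (- I) (- f ` I)"
    using finite_same_card_bij[of "- I" "- f ` I"] by auto
  define p where "p i = (if i \<in> I then f i else g i)" for i
  have "bij_betw p I (f ` I)" "bij_betw p (- I) (- f ` I)"
    using inj_on_imp_bij_betw[OF assms] g bij_betw_cong[of I p f] bij_betw_cong[of "- I" p g]
    by (simp_all add: p_def)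
  then have "bij_betw p (I \<union> - I) (f ` I \<union> - f ` I)"
    by (rule bij_betw_combine) auto
  then have "p permutes UNIV"
    by (simp add: permutes_univ bij_iff Compl_partition)
  then show ?thesis
    by (rule that) (simp add: p_def)
qed

text \<open>A countable dense subset is enumerated through the first component of a pairing; the
  free second component repeats each value at arbitrarily late indices.\<close>

lemma ex_recurring_dense_sequence:
  fixes X :: "'a::euclidean_space set"
  assumes "X \<noteq> {}"
  obtains x :: "nat \<Rightarrow> 'a" where "range x \<subseteq> X" "X \<subseteq> closure (range x)" "\<And>n N. \<exists>m\<ge>N. x m = x n"
proof -
  obtain T where T: "countable T" "T \<subseteq> X" "X \<subseteq> closure T"
    using separable[of X] by metis
  then have "T \<noteq> {}"
    using assms by auto
  define x where "x n = from_nat_into T (fst (prod_decode n))" for n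
  have fnT: "range (from_nat_into T) = T"
    using T(1) \<open>T \<noteq> {}\<close> by (simp add: range_from_nat_into)
  have "range x = from_nat_into T ` range (\<lambda>n. fst (prod_decode n))"
    by (simp add: image_image x_def)
  also have "range (\<lambda>n. fst (prod_decode n)) = UNIV"
    by (rule surjI[of _ "\<lambda>l. prod_encode (l, 0)"]) simp
  finally have "range x = T"
    by (simp add: fnT)
  have recurs: "\<exists>m\<ge>N. x m = x n" for n N
  proof (intro exI conjI)
    show "N \<le> prod_encode (fst (prod_decode n), N)"
      by (rule le_prod_encode_2)
    show "x (prod_encode (fst (prod_decode n), N)) = x n"
      by (simp add: x_def)
  qed
  show ?thesis
    by (rule that[of x]) (use T recurs \<open>range x = T\<close> in auto)
qed

subsection \<open>The set attached to a sequence of directions\<close>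

lemma ex_index_bound:
  fixes c e :: real
  assumes "e > 0"
  obtains N where "\<And>n. n \<ge> N \<Longrightarrow> c / real (Suc n) < e"
proof -
  obtain N :: nat where N: "c / e < real N"
    using reals_Archimedean2 by blast
  have "c / real (Suc n) < e" if "n \<ge> N" for n
  proof -
    have "c / e < real (Suc n)"
      using N that by linarith
    then show ?thesis
      using assms by (simp add: field_simps)
  qed
  then show ?thesis
    by (rule that)
qed

text \<open>The tolerance of block \<open>n\<close> is proportional to \<open>\<delta> n\<close>, a
  lower bound for the nonzero coordinates of \<open>x n\<close>. Thus the error stays small relative
  to the vector even if only its smallest nonzero coordinate is kept.\<close>

locale growing_blocks =
  fixes X :: "(real ^ 'k) set" and x :: "nat \<Rightarrow> real ^ 'k" and a :: "nat \<Rightarrow> nat ^ 'k"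
    and M \<delta> :: "nat \<Rightarrow> real"
  assumes X_sphere: "X \<subseteq> nonneg_sphere"
    and X_permute: "y \<in> X \<Longrightarrow> p permutes UNIV \<Longrightarrow> permute_coords p y \<in> X"
    and X_rho_on: "y \<in> X \<Longrightarrow> meets I y \<Longrightarrow> rho_on I y \<in> X"
    and x_in: "x n \<in> X"
    and x_dense: "X \<subseteq> closure (range x)"
    and x_recurs: "\<exists>m\<ge>N. x m = x n"
    and \<delta>_pos: "\<delta> n > 0"
    and \<delta>_le: "x n $ i \<noteq> 0 \<Longrightarrow> \<delta> n \<le> x n $ i"
    and M_pos: "M n > 0"
    and inj_a: "inj (($) (a n))"
    and a_close: "\<bar>real (a n $ i) - M n * x n $ i\<bar> \<le> \<delta> n / real (Suc n) * M n"
    and rho_a_neq: "rho (\<chi> i. real (a n $ i)) \<noteq> x n"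
    and a_pos: "x n $ i \<noteq> 0 \<Longrightarrow> a n $ i > 0"
    and a_small: "m < n \<Longrightarrow> real (a m $ i) \<le> \<delta> n / real (Suc n) * M n"
    and a_less: "m < n \<Longrightarrow> x n $ j \<noteq> 0 \<Longrightarrow> a m $ i < a n $ j"
begin

text \<open>Restricting to nonzero coordinates ensures that the latest block used by a tuple
  contributes a coordinate where its point does not vanish, and that \<open>a_pos\<close> and
  \<open>a_less\<close> apply.\<close>

definition blocks :: "nat set" where
  "blocks = {a n $ i | n i. x n $ i \<noteq> 0}"

lemma blocks_pos: "blocks \<subseteq> {n. n > 0}"
  using a_pos by (auto simp: blocks_def)

lemma norm_x: "norm (x n) = 1"
  using x_in X_sphere by (auto simp: nonneg_sphere_def)

lemma ex_support: "\<exists>i. x n $ i \<noteq> 0"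
proof (rule ccontr)
  assume "\<not> ?thesis"
  then have "x n = 0"
    by (simp add: vec_eq_iff)
  then show False
    using norm_x[of n] by simp
qed

text \<open>Entries on \<open>I\<close> are controlled by \<open>a_close\<close>, those off
  \<open>I\<close> by \<open>a_small\<close>. The coordinate \<open>j\<close> gives the truncated
  vector norm at least \<open>\<delta> n\<close>, which cancels the factor \<open>\<delta> n\<close>
  of the tolerance.\<close>

lemma dist_rho_block_le:
  assumes p: "p permutes UNIV" and I: "j \<in> I" "x n $ p j \<noteq> 0"
    and on: "\<And>i. i \<in> I \<Longrightarrow> b $ i = a n $ p i"
    and off: "\<And>i. i \<notin> I \<Longrightarrow> \<exists>m<n. \<exists>l. b $ i = a m $ l"
  shows "dist (rho (\<chi> i. real (b $ i))) (rho_on I (permute_coords p (x n)))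
    \<le> 2 * real CARD('k) / real (Suc n)"
proof -
  define w where "w = (\<chi> i. if i \<in> I then permute_coords p (x n) $ i else 0)"
  have "\<delta> n \<le> w $ j"
    using I \<delta>_le by (simp add: w_def permute_coords_def)
  also have "\<dots> \<le> norm w"
    using component_le_norm_cart[of w j] by simp
  finally have w: "\<delta> n \<le> norm w" .
  then have "w \<noteq> 0"
    using \<delta>_pos[of n] by auto
  have "\<bar>(\<chi> i. real (b $ i)) $ i - M n * w $ i\<bar> \<le> \<delta> n / real (Suc n) * M n" for i
  proof (cases "i \<in> I")
    case True
    then show ?thesis
      using a_close[of n "p i"] on by (simp add: w_def permute_coords_def)
  next
    case False
    then obtain m l where "m < n" "b $ i = a m $ l"
      using off by blast
    then show ?thesis
      using a_small[of m n l] False by (simp add: w_def)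
  qed
  from dist_rho_le[OF M_pos \<open>w \<noteq> 0\<close> this]
  have "dist (rho (\<chi> i. real (b $ i))) (rho w)
      \<le> 2 * real CARD('k) * (\<delta> n / real (Suc n)) / norm w" .
  also have "\<dots> = 2 * real CARD('k) / real (Suc n) * (\<delta> n / norm w)"
    by simp
  also have "\<dots> \<le> 2 * real CARD('k) / real (Suc n) * 1"
    using w \<open>w \<noteq> 0\<close> by (intro mult_left_mono) auto
  finally show ?thesis
    by (simp add: rho_on_def w_def)
qed

lemma islimpt_direction_set_blocks_imp_closure:
  assumes y: "y islimpt direction_set blocks"
  shows "y \<in> closure X"
  unfolding closure_approachable
proof (intro allI impI)
  fix e :: real assume "e > 0"
  then obtain N where N: "\<And>n. n \<ge> N \<Longrightarrow> 2 * real CARD('k) / real (Suc n) < e / 2"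
    using ex_index_bound[of "e / 2" "2 * real CARD('k)"] by auto
  \<comment> \<open>These are the entries of the blocks before \<open>N\<close>; a tuple with an
    entry outside them must use a block of index at least \<open>N\<close>.\<close>
  have "finite ((\<lambda>(m, i). a m $ i) ` ({..<N} \<times> UNIV))"
    by simp
  moreover have "e / 2 > 0"
    using \<open>e > 0\<close> by simp
  ultimately obtain b i0 where b: "b \<in> distinct_tuples blocks"
    and i0: "b $ i0 \<notin> (\<lambda>(m, i). a m $ i) ` ({..<N} \<times> UNIV)"
    and yb: "dist (rho (\<chi> i. real (b $ i))) y < e / 2"
    using islimpt_direction_set_large[OF y] by metis
  have "\<forall>i. \<exists>m l. b $ i = a m $ l \<and> x m $ l \<noteq> 0"
    using b unfolding distinct_tuples_def blocks_def by blast
  then obtain m l where ml: "\<And>i. b $ i = a (m i) $ l i" "\<And>i. x (m i) $ l i \<noteq> 0"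
    by metis
  define n where "n = Max (range m)"
  have m_le: "m i \<le> n" for i
    by (simp add: n_def)
  have "n \<in> range m"
    unfolding n_def by (intro Max_in) auto
  then obtain j where j: "m j = n"
    by auto
  have "m i0 \<ge> N"
    using i0 ml(1)[of i0] by (force simp: image_iff)
  then have "n \<ge> N"
    using m_le[of i0] by simp
  define I where "I = {i. m i = n}"
  \<comment> \<open>Distinct positions filled from block \<open>n\<close> use distinct coordinates
    of it, so \<open>l\<close> on \<open>I\<close> extends to a permutation of all
    coordinates.\<close>
  have "inj_on l I"
  proof (rule inj_onI)
    fix i i' assume "i \<in> I" "i' \<in> I" "l i = l i'"
    then have "b $ i = b $ i'"
      by (simp add: ml(1) I_def)
    then show "i = i'"
      using b by (auto simp: distinct_tuples_def)
  qed
  then obtain p where p: "p permutes UNIV" "\<And>i. i \<in> I \<Longrightarrow> p i = l i"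
    by (rule inj_on_extends_permutation) blast
  have jI: "j \<in> I" "x n $ p j \<noteq> 0"
    using j p(2)[of j] ml(2)[of j] by (simp_all add: I_def)
  let ?z = "rho_on I (permute_coords p (x n))"
  have "dist (rho (\<chi> i. real (b $ i))) ?z \<le> 2 * real CARD('k) / real (Suc n)"
  proof (rule dist_rho_block_le[OF p(1) jI])
    show "b $ i = a n $ p i" if "i \<in> I" for i
      using that p(2)[OF that] ml(1)[of i] by (simp add: I_def)
    show "\<exists>m<n. \<exists>l. b $ i = a m $ l" if "i \<notin> I" for i
      using that m_le[of i] ml(1)[of i] by (auto simp: I_def le_less)
  qed
  then have "dist (rho (\<chi> i. real (b $ i))) ?z < e / 2"
    using N[OF \<open>n \<ge> N\<close>] by linarith
  then have "dist ?z y < e"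
    using yb dist_triangle3[of ?z y "rho (\<chi> i. real (b $ i))"] by linarith
  moreover have "meets I (permute_coords p (x n))"
    using jI by (auto simp: meets_def permute_coords_def)
  then have "?z \<in> X"
    by (intro X_rho_on X_permute x_in p(1))
  ultimately show "\<exists>z\<in>X. dist z y < e"
    by blast
qed

text \<open>Where \<open>x n\<close> vanishes, \<open>a n\<close> is replaced by entries from
  distinct earlier blocks, of which \<open>n \<ge> CARD('k)\<close> guarantees enough. If
  \<open>x n\<close> has full support nothing is replaced, and \<open>rho_a_neq\<close> becomes
  available.\<close>

lemma ex_tuple_near:
  assumes "n \<ge> CARD('k)"
  obtains b where "b \<in> distinct_tuples blocks"
    "dist (rho (\<chi> i. real (b $ i))) (x n) \<le> 2 * real CARD('k) / real (Suc n)"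
    "(\<forall>i. x n $ i \<noteq> 0) \<Longrightarrow> b = a n"
proof -
  obtain s where s: "\<And>m. x m $ s m \<noteq> 0"
    using ex_support by metis
  \<comment> \<open>One entry per block, strictly increasing with the block: fillers differ from
    each other and lie below the entries used from block \<open>n\<close>.\<close>
  define c where "c m = a m $ s m" for m
  have c: "strict_mono c"
    using a_less s by (simp add: strict_mono_def c_def)
  obtain g :: "'k \<Rightarrow> nat" where g: "range g \<subseteq> {..<n}" "inj g"
    using card_le_inj[of "UNIV :: 'k set" "{..<n}"] assms by auto
  define b :: "nat ^ 'k" where "b = (\<chi> i. if x n $ i \<noteq> 0 then a n $ i else c (g i))"
  have gn: "g i < n" for i
    using g(1) by auto
  have b_in: "b $ i \<in> blocks" for i
    using s by (auto simp: b_def c_def blocks_def)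
  have b_less: "c (g i) < a n $ i'" if "x n $ i' \<noteq> 0" for i i'
    unfolding c_def by (rule a_less[OF gn that])
  have "b $ i \<noteq> b $ i'" if "i \<noteq> i'" for i i'
    using that b_less[of i i'] b_less[of i' i] inj_eq[OF inj_a[of n], of i i']
      inj_eq[OF g(2), of i i'] strict_mono_eq[OF c, of "g i" "g i'"]
    by (auto simp: b_def)
  then have b: "b \<in> distinct_tuples blocks"
    using b_in by (auto simp: distinct_tuples_def)
  let ?I = "{i. x n $ i \<noteq> 0}"
  have "(\<chi> i. if x n $ i \<noteq> 0 then x n $ i else 0) = x n"
    by (simp add: vec_eq_iff)
  then have "rho_on ?I (permute_coords id (x n)) = x n"
    by (simp add: rho_on_def permute_coords_def rho_def norm_x)
  moreover have "dist (rho (\<chi> i. real (b $ i))) (rho_on ?I (permute_coords id (x n)))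
    \<le> 2 * real CARD('k) / real (Suc n)"
    by (rule dist_rho_block_le[where j = "s n"]) (use s gn in \<open>auto simp: b_def c_def permutes_id\<close>)
  moreover have "b = a n" if "\<forall>i. x n $ i \<noteq> 0"
    using that by (simp add: b_def)
  ultimately show ?thesis
    using b that[of b] by simp
qed

lemma islimpt_direction_set_blocks:
  assumes y: "y \<in> X"
  shows "y islimpt direction_set blocks"
  unfolding islimpt_approachable
proof (intro allI impI)
  fix e :: real assume "e > 0"
  obtain m where m: "dist (x m) y < e / 2"
    using y x_dense \<open>e > 0\<close> closure_approachable[of y "range x"] half_gt_zero by blast
  \<comment> \<open>If \<open>x m\<close> differs from \<open>y\<close>, being closer than
    \<open>r\<close> to \<open>x m\<close> already excludes \<open>y\<close>. Otherwise
    \<open>y\<close> is avoided by \<open>rho_a_neq\<close> under full support, and by a zero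
    coordinate of \<open>y\<close> in the remaining case.\<close>
  define r where "r = (if x m = y then e / 2 else min (e / 2) (dist (x m) y))"
  have "r > 0"
    using \<open>e > 0\<close> by (simp add: r_def)
  then obtain N where N: "\<And>n. n \<ge> N \<Longrightarrow> 2 * real CARD('k) / real (Suc n) < r"
    using ex_index_bound[of r "2 * real CARD('k)"] by auto
  obtain n where n: "n \<ge> max N CARD('k)" "x n = x m"
    using x_recurs by blast
  then obtain b where b: "b \<in> distinct_tuples blocks"
    "dist (rho (\<chi> i. real (b $ i))) (x n) \<le> 2 * real CARD('k) / real (Suc n)"
    "(\<forall>i. x n $ i \<noteq> 0) \<Longrightarrow> b = a n"
    using ex_tuple_near[of n] by auto
  let ?z = "rho (\<chi> i. real (b $ i))"
  have zr: "dist ?z (x m) < r"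
    using N[of n] b(2) n by simp
  have "?z \<noteq> y"
  proof (cases "x m = y")
    case False
    then show ?thesis
      using zr by (auto simp: r_def dist_commute)
  next
    case True
    show ?thesis
    proof (cases "\<forall>i. x n $ i \<noteq> 0")
      case True
      then show ?thesis
        using b(3) rho_a_neq[of n] n(2) \<open>x m = y\<close> by simp
    next
      case False
      then obtain i where "y $ i = 0"
        using n(2) \<open>x m = y\<close> by auto
      then show ?thesis
        using rho_tuple_pos[OF b(1) blocks_pos, of i] by auto
    qed
  qed
  moreover have "r \<le> e / 2"
    unfolding r_def by (cases "x m = y") simp_all
  then have "dist ?z y < e"
    using zr m dist_triangle[of ?z y "x m"] by linarith
  moreover have "?z \<in> direction_set blocks"
    using b(1) unfolding direction_set_def by blast
  ultimately show "\<exists>z\<in>direction_set blocks. z \<noteq> y \<and> dist z y < e"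
    by blast
qed

end

section \<open>Realising a given nonempty set, and the equivalence\<close>

lemma ex_direction_set_derived:
  fixes X :: "(real ^ 'k) set"
  assumes card: "CARD('k) \<ge> 2" and sphere: "X \<subseteq> nonneg_sphere" and "closed X"
    and perm: "\<And>y p. y \<in> X \<Longrightarrow> p permutes UNIV \<Longrightarrow> permute_coords p y \<in> X"
    and rho_on: "\<And>y I. y \<in> X \<Longrightarrow> meets I y \<Longrightarrow> rho_on I y \<in> X"
    and "X \<noteq> {}"
  obtains A where "A \<subseteq> {n. n > 0}" "X = {y. y islimpt direction_set A}"
proof -
  obtain x :: "nat \<Rightarrow> real ^ 'k"
    where x: "range x \<subseteq> X" "X \<subseteq> closure (range x)" "\<And>n N. \<exists>m\<ge>N. x m = x n"
    by (rule ex_recurring_dense_sequence[OF \<open>X \<noteq> {}\<close>]) (rule that)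
  then have x_in: "x n \<in> X" for n
    by blast
  have x_nonneg: "x n $ i \<ge> 0" for n i
    using x_in[of n] sphere by (auto simp: nonneg_sphere_def)
  \<comment> \<open>The element 1 makes the minimum range over a visibly nonempty set.\<close>
  define \<delta> where "\<delta> n = Min (insert 1 {x n $ i | i. x n $ i \<noteq> 0})" for n
  have \<delta>_pos: "\<delta> n > 0" for n
    unfolding \<delta>_def using x_nonneg[of n] by (subst Min_gr_iff) (auto simp: less_le)
  have \<delta>_le: "\<delta> n \<le> x n $ i" if "x n $ i \<noteq> 0" for n i
    unfolding \<delta>_def using that by (intro Min_le) auto
  have eps_pos: "\<delta> n / real (Suc n) > 0" for n
    using \<delta>_pos by simp
  obtain a M where blocks:
    "\<And>n. M n > 0" "\<And>n. inj (($) (a n))"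
    "\<And>n i. \<bar>real (a n $ i) - M n * x n $ i\<bar> \<le> \<delta> n / real (Suc n) * M n"
    "\<And>n. rho (\<chi> i. real (a n $ i)) \<noteq> x n"
    "\<And>n i. x n $ i \<noteq> 0 \<Longrightarrow> a n $ i > 0"
    "\<And>m n i. m < n \<Longrightarrow> real (a m $ i) \<le> \<delta> n / real (Suc n) * M n"
    "\<And>m n i j. m < n \<Longrightarrow> x n $ j \<noteq> 0 \<Longrightarrow> a m $ i < a n $ j"
    by (rule ex_growing_blocks[where x = x and \<epsilon> = "\<lambda>n. \<delta> n / real (Suc n)",
        OF card x_nonneg eps_pos])
      (rule that)
  interpret growing_blocks X x a M \<delta>
    by unfold_locales (fact sphere perm rho_on x_in x(2,3) \<delta>_pos \<delta>_le blocks)+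
  have "X = {y. y islimpt direction_set blocks}"
    using islimpt_direction_set_blocks islimpt_direction_set_blocks_imp_closure
      closure_closed[OF \<open>closed X\<close>] by blast
  then show ?thesis
    using that blocks_pos by blast
qed

theorem theorem1p2:
  fixes X :: "(real ^ 'k) set"
  assumes "CARD('k) \<ge> 2"
    and "X \<subseteq> nonneg_sphere"
  shows "(\<exists>A :: nat set. A \<subseteq> {n. n > 0} \<and>
            X = top_of_set nonneg_sphere derived_set_of direction_set A)
    \<longleftrightarrow>
      closedin (top_of_set nonneg_sphere) X \<and>
      (\<forall>x\<in>X. \<forall>p. p permutes (UNIV :: 'k set) \<longrightarrow> permute_coords p x \<in> X) \<and>
      (\<forall>x\<in>X. \<forall>I. meets I x \<longrightarrow> rho_on I x \<in> X)"
    (is "?L \<longleftrightarrow> ?R")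
proof
  assume ?L
  then obtain A where A: "A \<subseteq> {n. n > 0}" and X: "X = {y. y islimpt direction_set A}"
    by (metis derived_set_direction_set)
  have "closed X"
    unfolding X by (rule closed_limpts)
  then have "closedin (top_of_set nonneg_sphere) X"
    using assms(2) by (intro closed_subset)
  then show ?R
    using derived_direction_set_permute derived_direction_set_rho_on[OF _ A] unfolding X by blast
next
  assume R: ?R
  have "closed X"
    using R closedin_closed_trans[OF _ closed_nonneg_sphere] by blast
  show ?L
  proof (cases "X = {}")
    case True
    \<comment> \<open>No sequence of points can be drawn from an empty \<open>X\<close>; the empty
      set of integers has no tuples and hence no directions.\<close>
    then have "X = top_of_set nonneg_sphere derived_set_of direction_set {}"
      by (simp add: direction_set_def distinct_tuples_def)
    then show ?thesis
      by blast
  next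
    case False
    obtain A where "A \<subseteq> {n. n > 0}" "X = {y. y islimpt direction_set A}"
      using ex_direction_set_derived[OF assms \<open>closed X\<close> _ _ False] R by metis
    then show ?thesis
      using derived_set_direction_set by metis
  qed
qed

end
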